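(* Let $X=\{x_0,x_1,\dots,x_n\}$ (with $x_0,\dots,x_n$ distinct) and let $(X,d)$ be a finite metric space with $\operatorname{mgr}(X)<\infty$. Then $$\operatorname{mgr}(X)=\min\{p>0:\det(M_p)=0\}=\min\{p>0:\det(G_p)=0\},$$ where $M_p$ is the Cayley-Menger matrix and $G_p$ the Gramian of $(X,d)$ with exponent $p$. (In particular, both minima exist.)
   Context: Maximal generalised roundness: for $p\ge 0$, a metric space $(X,d)$ is of $p$-negative type if $\sum_{i,j=1}^{k} d(y_i,y_j)^p\,\xi_i\xi_j\le 0$ for all finite collections $y_1,\dots,y_k\in X$ and all $\xi_1,\dots,\xi_k\in\mathbb{R}$ with $\xi_1+\dots+\xi_k=0$. It has generalised roundness $p$ if $\sum_{i,j=1}^{k}\big(d(y_i,y_j)^p+d(z_i,z_j)^p\big)\le 2\sum_{i,j=1}^{k}d(y_i,z_j)^p$ for all finite collections $y_1,\dots,y_k,z_1,\dots,z_k\in X$. It is known (Lennard, Tonge and Weston) that the set of $p$ for which $(X,d)$ is of $p$-negative type equals the set of $p$ for which it has generalised roundness $p$, and that this set is of the form $[0,\wp]$ or $[0,\infty)$. The maximal generalised roundness $\operatorname{mgr}(X,d)=\operatorname{mgr}(X)$ (also called the supremal $p$-negative type) is the supremum of this set, i.e. $\wp$ or $\infty$ respectively. Matrices: for $p>0$, $D_p=(d(x_i,x_j)^p)_{i,j=0}^n$ is the $(n+1)\times(n+1)$ $p$-distance matrix, and $\mathbf{1}$ is the column vector in $\mathbb{R}^{n+1}$ all of whose coordinates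 are $1$. The Cayley-Menger matrix is the $(n+2)\times(n+2)$ block matrix $$M_p=\begin{pmatrix}0&\mathbf{1}^T\\ \mathbf{1}&D_p\end{pmatrix}.$$ The Gramian is the $n\times n$ matrix $G_p=(g_{ij})_{i,j=1}^n$ with entries $$g_{ij}=\tfrac12\big(d(x_i,x_0)^p+d(x_j,x_0)^p-d(x_i,x_j)^p\big).$$ *)

theory Defs
  imports "HOL-Library.Extended_Real" "HOL-Analysis.Abstract_Metric_Spaces"
    "Jordan_Normal_Form.Determinant"
begin

text \<open>
  The real powers are written with \<open>powr\<close>, for which \<open>0 powr 0 = 0\<close>. The value of \<open>0 powr 0\<close> matters
  only for exponent 0, where the inequality below holds for every metric space with either convention.
  The points \<open>y 0, \<dots>, y (k - 1)\<close>, and likewise the \<open>z i\<close>, need not be distinct.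
\<close>

definition generalised_roundness :: "'a set \<Rightarrow> ('a \<Rightarrow> 'a \<Rightarrow> real) \<Rightarrow> real \<Rightarrow> bool" where
  "generalised_roundness X d p \<longleftrightarrow>
     (\<forall>(k::nat) y z. (\<forall>i<k. y i \<in> X \<and> z i \<in> X) \<longrightarrow>
        (\<Sum>i<k. \<Sum>j<k. d (y i) (y j) powr p + d (z i) (z j) powr p)
          \<le> 2 * (\<Sum>i<k. \<Sum>j<k. d (y i) (z j) powr p))"

definition mgr :: "'a set \<Rightarrow> ('a \<Rightarrow> 'a \<Rightarrow> real) \<Rightarrow> ereal" where
  "mgr X d = Sup (ereal ` {p. 0 \<le> p \<and> generalised_roundness X d p})"

definition distance_mat :: "('a \<Rightarrow> 'a \<Rightarrow> real) \<Rightarrow> (nat \<Rightarrow> 'a) \<Rightarrow> nat \<Rightarrow> real \<Rightarrow> real mat" where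
  "distance_mat d x n p = mat (n + 1) (n + 1) (\<lambda>(i, j). d (x i) (x j) powr p)"

definition cayley_menger_mat :: "('a \<Rightarrow> 'a \<Rightarrow> real) \<Rightarrow> (nat \<Rightarrow> 'a) \<Rightarrow> nat \<Rightarrow> real \<Rightarrow> real mat" where
  "cayley_menger_mat d x n p =
     four_block_mat (0\<^sub>m 1 1) (mat 1 (n + 1) (\<lambda>_. 1))
                    (mat (n + 1) 1 (\<lambda>_. 1)) (distance_mat d x n p)"

text \<open>Matrix indices start at 0, so entry \<open>(i, j)\<close> belongs to the points \<open>x (i + 1)\<close> and \<open>x (j + 1)\<close>.\<close>

definition gramian_mat :: "('a \<Rightarrow> 'a \<Rightarrow> real) \<Rightarrow> (nat \<Rightarrow> 'a) \<Rightarrow> nat \<Rightarrow> real \<Rightarrow> real mat" where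
  "gramian_mat d x n p =
     mat n n (\<lambda>(i, j). (d (x (i + 1)) (x 0) powr p + d (x (j + 1)) (x 0) powr p
                        - d (x (i + 1)) (x (j + 1)) powr p) / 2)"

text \<open>\<open>Min\<close> is only meaningful for finite sets, and \<open>Inf\<close> need not be attained.\<close>

definition is_minimum :: "real \<Rightarrow> real set \<Rightarrow> bool" where
  "is_minimum m S \<longleftrightarrow> m \<in> S \<and> (\<forall>s\<in>S. m \<le> s)"

end

theory Submission
  imports Defs "HOL-Analysis.Equivalence_Lebesgue_Henstock_Integration"
begin

text \<open>
  Call a kernel \<open>s\<close> on a finite set of negative type if its quadratic form is nonpositive on the vectors
  with coordinate sum 0, and of strict negative type if it is negative on the nonzero ones. Let
  \<open>s p\<close> be the kernel of \<open>p\<close>-th powers of the distances. Three things make the theorem true.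

  Generalised roundness \<open>p\<close> says that \<open>s p\<close> is of negative type: counting how often each point
  occurs among the \<open>y i\<close> and among the \<open>z i\<close> turns the roundness inequality into the form evaluated
  at an integer vector with sum 0, and by homogeneity and continuity the integer vectors decide the sign
  (\<open>generalised_roundness_iff_neg_type\<close>).

  Both determinants vanish exactly when some nonzero vector \<open>\<xi>\<close> with sum 0 has a constant potential
  \<open>s p \<xi>\<close> (\<open>det_cayley_menger_mat_eq_0_iff\<close>, \<open>det_gramian_mat_eq_0_iff\<close>). Such a vector has
  form value 0, so it cannot exist for a kernel of strict negative type; it does exist for a kernel of
  negative type that is not strict, because a maximiser of the form on the sum-zero hyperplane is
  a critical point there, with the constant as the Lagrange multiplier.

  Finally, negative type of \<open>s q\<close> implies strict negative type of \<open>s p\<close> for all \<open>0 < p < q\<close>. With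
  \<open>\<alpha> = p / q\<close>, the power \<open>r powr \<alpha>\<close> is a positive multiple of the integral of
  \<open>(1 - exp (- t r)) t powr (- 1 - \<alpha>)\<close> over \<open>t > 0\<close>, and the kernels \<open>exp (- t s)\<close> are positive
  semidefinite by Schoenberg's argument, which rests on the Schur product theorem. The form of
  \<open>s p\<close> is therefore an integral of nonpositive terms, and these are negative for large \<open>t\<close>, where
  \<open>exp (- t s)\<close> approaches the identity matrix (\<open>neg_type_powr_imp_strict\<close>).

  Let \<open>m\<close> be the supremum of the exponents of negative type. Negative type is a closed condition on
  the exponent, so it holds at \<open>m\<close>. Strict negative type is an open condition, so it fails at \<open>m\<close>: it would
  persist beyond the supremum. It holds at exponent 0, where all nonzero distances become 1, and so \<open>m > 0\<close>. Hence the
  determinants vanish at \<open>m\<close>, and they do not vanish at any \<open>p\<close> with \<open>0 < p < m\<close>.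
\<close>

section \<open>Quadratic forms and positive semidefinite kernels\<close>

definition quadratic_form :: "'a set \<Rightarrow> ('a \<Rightarrow> 'a \<Rightarrow> real) \<Rightarrow> ('a \<Rightarrow> real) \<Rightarrow> real" where
  "quadratic_form X s \<xi> = (\<Sum>a\<in>X. \<Sum>b\<in>X. s a b * \<xi> a * \<xi> b)"

definition psd_kernel :: "'a set \<Rightarrow> ('a \<Rightarrow> 'a \<Rightarrow> real) \<Rightarrow> bool" where
  "psd_kernel X s \<longleftrightarrow> (\<forall>a\<in>X. \<forall>b\<in>X. s a b = s b a) \<and> (\<forall>\<xi>. 0 \<le> quadratic_form X s \<xi>)"

lemma quadratic_form_cong:
  assumes "\<And>a b. a \<in> X \<Longrightarrow> b \<in> X \<Longrightarrow> s a b = s' a b" "\<And>a. a \<in> X \<Longrightarrow> \<xi> a = \<xi>' a"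
  shows "quadratic_form X s \<xi> = quadratic_form X s' \<xi>'"
  unfolding quadratic_form_def using assms by (intro sum.cong) auto

lemma quadratic_form_cmult: "quadratic_form X (\<lambda>a b. c * s a b) \<xi> = c * quadratic_form X s \<xi>"
  unfolding quadratic_form_def by (simp add: sum_distrib_left mult_ac)

lemma quadratic_form_scale:
  "quadratic_form X s (\<lambda>a. c * \<xi> a) = c\<^sup>2 * quadratic_form X s \<xi>"
  unfolding quadratic_form_def by (simp add: sum_distrib_left power2_eq_square mult_ac)

lemma quadratic_form_rank_one:
  "quadratic_form X (\<lambda>a b. v a * v b) \<xi> = (\<Sum>a\<in>X. v a * \<xi> a)\<^sup>2"
  unfolding quadratic_form_def power2_eq_square sum_product by (simp add: mult_ac)

lemma quadratic_form_kernel_add: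
  "quadratic_form X (\<lambda>a b. s a b + s' a b) \<xi> = quadratic_form X s \<xi> + quadratic_form X s' \<xi>"
  unfolding quadratic_form_def by (simp add: sum.distrib distrib_right)

lemma quadratic_form_kernel_sum:
  "quadratic_form X (\<lambda>a b. \<Sum>k\<in>K. s k a b) \<xi> = (\<Sum>k\<in>K. quadratic_form X (s k) \<xi>)"
  unfolding quadratic_form_def
  by (simp add: sum_distrib_right sum.swap[of _ K])

lemma quadratic_form_vec_add:
  assumes "\<And>a b. a \<in> X \<Longrightarrow> b \<in> X \<Longrightarrow> s a b = s b a"
  shows "quadratic_form X s (\<lambda>a. \<xi> a + t * \<eta> a) =
    quadratic_form X s \<xi> + 2 * t * (\<Sum>a\<in>X. \<eta> a * (\<Sum>b\<in>X. s a b * \<xi> b)) + t\<^sup>2 * quadratic_form X s \<eta>"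
proof -
  have *: "(\<Sum>a\<in>X. \<Sum>b\<in>X. s a b * \<xi> a * \<eta> b) = (\<Sum>a\<in>X. \<Sum>b\<in>X. s a b * \<eta> a * \<xi> b)"
    by (subst sum.swap) (intro sum.cong refl, simp add: assms mult_ac)
  have "quadratic_form X s (\<lambda>a. \<xi> a + t * \<eta> a) =
     (\<Sum>a\<in>X. \<Sum>b\<in>X. s a b * \<xi> a * \<xi> b) + t * (\<Sum>a\<in>X. \<Sum>b\<in>X. s a b * \<xi> a * \<eta> b)
     + t * (\<Sum>a\<in>X. \<Sum>b\<in>X. s a b * \<eta> a * \<xi> b) + t\<^sup>2 * (\<Sum>a\<in>X. \<Sum>b\<in>X. s a b * \<eta> a * \<eta> b)"
    unfolding quadratic_form_def sum_distrib_left sum.distrib[symmetric]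
    by (intro sum.cong refl) (simp add: algebra_simps power2_eq_square)
  then show ?thesis unfolding * quadratic_form_def
    by (simp add: sum_distrib_left mult_ac)
qed

lemma affine_nonneg_imp_slope_zero:
  fixes c k :: real
  assumes "\<And>t. 0 \<le> t * c + k"
  shows "c = 0"
proof (rule ccontr)
  assume "c \<noteq> 0"
  then have "(- (k + 1) / c) * c + k = -1" by simp
  then show False using assms[of "- (k + 1) / c"] by simp
qed

lemma quadratic_form_delta:
  assumes "finite X" "i \<in> X"
  shows "quadratic_form X s (\<lambda>a. if a = i then 1 else 0) = s i i"
proof -
  have "quadratic_form X s (\<lambda>a. if a = i then 1 else 0) =
      (\<Sum>a\<in>X. \<Sum>b\<in>X. if b = i then (if a = i then s a b else 0) else 0)"
    unfolding quadratic_form_def by (intro sum.cong) auto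
  then show ?thesis using assms by simp
qed

text \<open>
  Otherwise the form would be affine with nonzero slope in \<open>t\<close>, and so negative somewhere, along the line
  \<open>e b + t * e i\<close> through the standard unit vectors.
\<close>

lemma psd_kernel_diag_zero:
  assumes X: "finite X" and psd: "psd_kernel X s" and i: "i \<in> X" "s i i = 0" and b: "b \<in> X"
  shows "s i b = 0"
proof -
  have sym: "\<And>a b. a \<in> X \<Longrightarrow> b \<in> X \<Longrightarrow> s a b = s b a"
    using psd by (auto simp: psd_kernel_def)
  define e where "e = (\<lambda>i a :: 'a. if a = i then (1::real) else 0)"
  have e_sum: "(\<Sum>a\<in>X. e i a * f a) = f i" "(\<Sum>a\<in>X. f a * e i a) = f i" if "i \<in> X" for i f
    using X that by (simp_all add: e_def if_distrib if_distribR cong: if_cong)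
  have e_form: "quadratic_form X s (e i) = s i i" if "i \<in> X" for i
    using quadratic_form_delta[OF X that] by (simp add: e_def)
  have "0 \<le> t * (2 * s i b) + s b b" for t
  proof -
    have "0 \<le> quadratic_form X s (\<lambda>a. e b a + t * e i a)"
      using psd by (auto simp: psd_kernel_def)
    also have "\<dots> = s b b + 2 * t * s i b"
      using i b
      by (subst quadratic_form_vec_add[OF sym]) (simp_all add: e_sum e_form)
    finally show ?thesis by simp
  qed
  from affine_nonneg_imp_slope_zero[OF this] show ?thesis by simp
qed

text \<open>
  The Schur complement at \<open>\<xi>\<close> is the value of the original form once the coordinate \<open>i\<close> is chosen
  to minimise it. If the pivot \<open>s i i\<close> is 0, then division by zero makes the correction vanish and
  the claim is about the restriction of \<open>s\<close>.
\<close>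

lemma psd_kernel_schur_complement:
  assumes X: "finite X" "i \<notin> X" and psd: "psd_kernel (insert i X) s"
  shows "psd_kernel X (\<lambda>a b. s a b - s a i * s b i / s i i)"
proof -
  have sym: "\<And>a b. a \<in> insert i X \<Longrightarrow> b \<in> insert i X \<Longrightarrow> s a b = s b a"
    using psd by (auto simp: psd_kernel_def)
  have "0 \<le> quadratic_form X (\<lambda>a b. s a b - s a i * s b i / s i i) \<xi>" for \<xi>
  proof -
    define l where "l = (\<Sum>b\<in>X. s b i * \<xi> b)"
    \<comment> \<open>The minimiser of the form over the coordinate \<open>i\<close>.\<close>
    define \<xi>' where "\<xi>' = \<xi>(i := - l / s i i)"
    have \<xi>': "\<xi>' i = - l / s i i" "a \<in> X \<Longrightarrow> \<xi>' a = \<xi> a" for a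
      using X by (auto simp: \<xi>'_def)
    have 1: "(\<Sum>b\<in>X. s i b * \<xi>' i * \<xi>' b) = \<xi>' i * l"
      unfolding l_def sum_distrib_left by (intro sum.cong refl) (simp add: \<xi>' sym)
    have 2: "(\<Sum>a\<in>X. s a i * \<xi>' a * \<xi>' i) = \<xi>' i * l"
      unfolding l_def sum_distrib_left by (intro sum.cong refl) (simp add: \<xi>')
    have 3: "(\<Sum>a\<in>X. \<Sum>b\<in>X. s a b * \<xi>' a * \<xi>' b) = quadratic_form X s \<xi>"
      unfolding quadratic_form_def by (intro sum.cong refl) (simp add: \<xi>')
    have "0 \<le> quadratic_form (insert i X) s \<xi>'"
      using psd by (auto simp: psd_kernel_def)
    also have "\<dots> = s i i * \<xi>' i * \<xi>' i + 2 * \<xi>' i * l + quadratic_form X s \<xi>"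
      unfolding quadratic_form_def using X
      by (simp add: sum.distrib 1 2 3[unfolded quadratic_form_def])
    also have "\<dots> = quadratic_form X s \<xi> - l\<^sup>2 / s i i"
      by (cases "s i i = 0") (auto simp: \<xi>' field_simps power2_eq_square)
    also have "\<dots> = quadratic_form X (\<lambda>a b. s a b + (- 1 / s i i) * (s a i * s b i)) \<xi>"
      unfolding quadratic_form_kernel_add quadratic_form_cmult quadratic_form_rank_one l_def by simp
    finally show ?thesis by simp
  qed
  then show ?thesis using sym by (auto simp: psd_kernel_def)
qed

text \<open>
  The Cholesky decomposition, by elimination of one point at a time. Indexing the vectors by \<open>X\<close>
  itself avoids a choice of enumeration.
\<close>

lemma psd_kernel_gram:
  assumes "finite X" "psd_kernel X s"
  shows "\<exists>v :: 'a \<Rightarrow> 'a \<Rightarrow> real. \<forall>a\<in>X. \<forall>b\<in>X. s a b = (\<Sum>k\<in>X. v k a * v k b)"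
  using assms
proof (induction X arbitrary: s)
  case (insert i X)
  have sym: "\<And>a b. a \<in> insert i X \<Longrightarrow> b \<in> insert i X \<Longrightarrow> s a b = s b a"
    using insert.prems by (auto simp: psd_kernel_def)
  have nonneg: "0 \<le> s i i"
    using insert.prems insert.hyps quadratic_form_delta[of "insert i X" i s]
    unfolding psd_kernel_def by (metis finite_insert insertI1)
  have zero: "s i b = 0" if "s i i = 0" "b \<in> insert i X" for b
    using psd_kernel_diag_zero[OF _ insert.prems] insert.hyps that by simp
  obtain w where w: "\<And>a b. a \<in> X \<Longrightarrow> b \<in> X \<Longrightarrow>
      s a b - s a i * s b i / s i i = (\<Sum>k\<in>X. w k a * w k b)"
    using insert.IH[OF psd_kernel_schur_complement[OF insert.hyps insert.prems]] by blast
  define v where "v = (\<lambda>k a. if k = i then s a i / sqrt (s i i) else if a = i then 0 else w k a)"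
  have "s a b = (\<Sum>k\<in>insert i X. v k a * v k b)" if ab: "a \<in> insert i X" "b \<in> insert i X" for a b
  proof -
    have "(\<Sum>k\<in>insert i X. v k a * v k b) = s a i * s b i / s i i + (\<Sum>k\<in>X. v k a * v k b)"
      using insert.hyps nonneg by (simp add: v_def)
    also have "(\<Sum>k\<in>X. v k a * v k b) = s a b - s a i * s b i / s i i"
    proof (cases "a = i \<or> b = i")
      case True
      then have "(\<Sum>k\<in>X. v k a * v k b) = 0"
        using insert.hyps by (intro sum.neutral) (auto simp: v_def)
      moreover have "s a b - s a i * s b i / s i i = 0"
        using True zero ab sym by (cases "s i i = 0") auto
      ultimately show ?thesis by simp
    next
      case False
      then have "(\<Sum>k\<in>X. v k a * v k b) = (\<Sum>k\<in>X. w k a * w k b)"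
        using insert.hyps by (intro sum.cong) (auto simp: v_def)
      then show ?thesis using w ab False by auto
    qed
    finally show ?thesis by simp
  qed
  then show ?case by blast
qed auto

text \<open>
  The Schur product theorem: a Gram decomposition of one factor writes the form of the product as a sum
  of values of the form of the other factor.
\<close>

lemma psd_kernel_schur_product:
  assumes X: "finite X" and A: "psd_kernel X A" and B: "psd_kernel X B"
  shows "psd_kernel X (\<lambda>a b. A a b * B a b)"
proof -
  obtain v where v: "\<And>a b. a \<in> X \<Longrightarrow> b \<in> X \<Longrightarrow> A a b = (\<Sum>k\<in>X. v k a * v k b)"
    using psd_kernel_gram[OF X A] by blast
  have "0 \<le> quadratic_form X (\<lambda>a b. A a b * B a b) \<xi>" for \<xi>
  proof -
    have "quadratic_form X (\<lambda>a b. A a b * B a b) \<xi>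
        = quadratic_form X (\<lambda>a b. \<Sum>k\<in>X. v k a * v k b * B a b) \<xi>"
      by (intro quadratic_form_cong) (simp_all add: v sum_distrib_right)
    also have "\<dots> = (\<Sum>k\<in>X. quadratic_form X B (\<lambda>a. v k a * \<xi> a))"
      unfolding quadratic_form_kernel_sum by (simp add: quadratic_form_def mult_ac)
    also have "\<dots> \<ge> 0"
      using B by (intro sum_nonneg) (auto simp: psd_kernel_def)
    finally show ?thesis .
  qed
  then show ?thesis using A B by (auto simp: psd_kernel_def)
qed

lemma psd_kernel_power:
  assumes "finite X" "psd_kernel X A"
  shows "psd_kernel X (\<lambda>a b. A a b ^ k)"
proof (induction k)
  case 0
  then show ?case using quadratic_form_rank_one[of X "\<lambda>_. 1"] by (simp add: psd_kernel_def)
next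
  case (Suc k)
  then show ?case using psd_kernel_schur_product[OF assms] by simp
qed

text \<open>
  The partial sums of the exponential series are nonnegative combinations of entrywise powers.
\<close>

lemma psd_kernel_exp:
  assumes X: "finite X" and A: "psd_kernel X A"
  shows "psd_kernel X (\<lambda>a b. exp (A a b))"
proof -
  have "0 \<le> quadratic_form X (\<lambda>a b. exp (A a b)) \<xi>" for \<xi>
  proof (rule LIMSEQ_le_const)
    have "(\<lambda>N. \<Sum>k<N. A a b ^ k /\<^sub>R fact k) \<longlonglongrightarrow> exp (A a b)" for a b
      using exp_converges[of "A a b"] by (simp add: sums_def)
    then show "(\<lambda>N. quadratic_form X (\<lambda>a b. \<Sum>k<N. A a b ^ k /\<^sub>R fact k) \<xi>)
        \<longlonglongrightarrow> quadratic_form X (\<lambda>a b. exp (A a b)) \<xi>"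
      unfolding quadratic_form_def by (intro tendsto_intros)
    have "0 \<le> quadratic_form X (\<lambda>a b. \<Sum>k<N. A a b ^ k /\<^sub>R fact k) \<xi>" for N
      unfolding quadratic_form_kernel_sum scaleR_conv_of_real
      using psd_kernel_power[OF X A]
      by (intro sum_nonneg) (auto simp: quadratic_form_cmult psd_kernel_def)
    then show "\<exists>N. \<forall>n\<ge>N. 0 \<le> quadratic_form X (\<lambda>a b. \<Sum>k<n. A a b ^ k /\<^sub>R fact k) \<xi>"
      by blast
  qed
  then show ?thesis using A by (auto simp: psd_kernel_def)
qed

section \<open>Negative type and the exponential kernel\<close>

definition neg_type :: "'a set \<Rightarrow> ('a \<Rightarrow> 'a \<Rightarrow> real) \<Rightarrow> bool" where
  "neg_type X s \<longleftrightarrow> (\<forall>\<xi>. (\<Sum>a\<in>X. \<xi> a) = 0 \<longrightarrow> quadratic_form X s \<xi> \<le> 0)"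

definition strict_neg_type :: "'a set \<Rightarrow> ('a \<Rightarrow> 'a \<Rightarrow> real) \<Rightarrow> bool" where
  "strict_neg_type X s \<longleftrightarrow>
    (\<forall>\<xi>. (\<Sum>a\<in>X. \<xi> a) = 0 \<longrightarrow> (\<exists>a\<in>X. \<xi> a \<noteq> 0) \<longrightarrow> quadratic_form X s \<xi> < 0)"

lemma strict_neg_type_imp_neg_type:
  assumes "strict_neg_type X s"
  shows "neg_type X s"
  unfolding neg_type_def
proof (intro allI impI)
  fix \<xi> :: "'a \<Rightarrow> real" assume "sum \<xi> X = 0"
  show "quadratic_form X s \<xi> \<le> 0"
  proof (cases "\<exists>a\<in>X. \<xi> a \<noteq> 0")
    case True
    then show ?thesis using assms \<open>sum \<xi> X = 0\<close> unfolding strict_neg_type_def by (simp add: less_imp_le)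
  next
    case False
    then show ?thesis by (simp add: quadratic_form_def)
  qed
qed

text \<open>
  On a vector with sum 0, this form is minus the squared Euclidean norm.
\<close>

lemma strict_neg_type_discrete:
  assumes X: "finite X"
  shows "strict_neg_type X (\<lambda>a b. if a = b then 0 else 1)"
  unfolding strict_neg_type_def
proof (intro allI impI)
  fix \<xi> :: "'a \<Rightarrow> real" assume sum0: "sum \<xi> X = 0" and nz: "\<exists>a\<in>X. \<xi> a \<noteq> 0"
  have "quadratic_form X (\<lambda>a b. if a = b then 0 else 1) \<xi> =
      (\<Sum>a\<in>X. \<Sum>b\<in>X. \<xi> a * \<xi> b - (if b = a then \<xi> a * \<xi> b else 0))"
    unfolding quadratic_form_def by (intro sum.cong) auto
  also have "\<dots> = sum \<xi> X * sum \<xi> X - (\<Sum>a\<in>X. (\<xi> a)\<^sup>2)"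
    using X by (simp add: sum_subtractf sum_product power2_eq_square)
  also have "\<dots> < 0"
    using X nz sum0 by (auto intro: sum_pos2)
  finally show "quadratic_form X (\<lambda>a b. if a = b then 0 else 1) \<xi> < 0" .
qed

text \<open>
  Changing the coordinate of \<open>\<xi>\<close> at the base point \<open>c\<close> makes its sum 0 and changes the form
  of \<open>s\<close> by the terms that involve \<open>c\<close>; what results is minus the form of the Gram kernel.
\<close>

lemma gram_kernel_psd:
  assumes X: "finite X" "c \<in> X" and sym: "\<And>a b. a \<in> X \<Longrightarrow> b \<in> X \<Longrightarrow> s a b = s b a"
    and s0: "s c c = 0" and neg: "neg_type X s"
  shows "psd_kernel X (\<lambda>a b. s a c + s b c - s a b)"
proof -
  have "0 \<le> quadratic_form X (\<lambda>a b. s a c + s b c - s a b) \<xi>" for \<xi>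
  proof -
    define S where "S = (\<Sum>a\<in>X. \<xi> a)"
    define l where "l = (\<Sum>a\<in>X. s a c * \<xi> a)"
    define e where "e = (\<lambda>a. if a = c then (1::real) else 0)"
    have e_sum: "(\<Sum>a\<in>X. e a * f a) = f c" for f
      using X by (simp add: e_def if_distrib if_distribR cong: if_cong)
    have l': "(\<Sum>a\<in>X. s c a * \<xi> a) = l"
      unfolding l_def using sym X by (intro sum.cong) auto
    have "(\<Sum>a\<in>X. \<xi> a + (- S) * e a) = 0"
      using e_sum[of "\<lambda>_. 1"] by (simp add: sum_subtractf sum_distrib_left[symmetric] S_def)
    then have "quadratic_form X s (\<lambda>a. \<xi> a + (- S) * e a) \<le> 0"
      using neg unfolding neg_type_def by blast
    also have "quadratic_form X s (\<lambda>a. \<xi> a + (- S) * e a) = quadratic_form X s \<xi> - 2 * S * l"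
      using X s0 l' by (subst quadratic_form_vec_add[OF sym])
        (simp_all add: e_sum quadratic_form_delta[OF X, folded e_def])
    also have "quadratic_form X (\<lambda>a b. s a c + s b c - s a b) \<xi> =
        (\<Sum>a\<in>X. \<Sum>b\<in>X. (s a c * \<xi> a) * \<xi> b) + (\<Sum>a\<in>X. \<Sum>b\<in>X. \<xi> a * (s b c * \<xi> b)) - quadratic_form X s \<xi>"
      unfolding quadratic_form_def sum.distrib[symmetric] sum_subtractf[symmetric]
      by (intro sum.cong refl) (simp add: algebra_simps)
    then have "quadratic_form X s \<xi> - 2 * S * l = - quadratic_form X (\<lambda>a b. s a c + s b c - s a b) \<xi>"
      by (simp add: sum_product[symmetric] S_def l_def)
    finally show ?thesis by simp
  qed
  then show ?thesis using sym by (auto simp: psd_kernel_def)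
qed

text \<open>
  Schoenberg's theorem. Up to the rank one factor \<open>w a * w b\<close>, this kernel is the entrywise
  exponential of a nonnegative multiple of the Gram kernel at a base point.
\<close>

lemma neg_type_imp_psd_kernel_exp:
  assumes X: "finite X" and sym: "\<And>a b. a \<in> X \<Longrightarrow> b \<in> X \<Longrightarrow> s a b = s b a"
    and s0: "\<And>a. a \<in> X \<Longrightarrow> s a a = 0" and neg: "neg_type X s" and t: "0 \<le> t"
  shows "psd_kernel X (\<lambda>a b. exp (- (t * s a b)))"
proof (cases "X = {}")
  case False
  then obtain c where c: "c \<in> X" by blast
  define g where "g = (\<lambda>a b. s a c + s b c - s a b)"
  have g: "psd_kernel X g"
    unfolding g_def by (rule gram_kernel_psd[OF X c sym s0 neg]) (use c in auto)
  then have tg: "psd_kernel X (\<lambda>a b. t * g a b)"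
    using t by (auto simp: psd_kernel_def quadratic_form_cmult)
  \<comment> \<open>The factor by which \<open>exp (- t s)\<close> differs from the exponential of the Gram kernel.\<close>
  define w where "w = (\<lambda>a. exp (- (t * s a c)))"
  have "exp (- (t * s a b)) = exp (t * g a b) * (w a * w b)" for a b
  proof -
    have "- (t * s a b) = t * g a b + (- (t * s a c) + - (t * s b c))"
      by (simp add: g_def algebra_simps)
    then show ?thesis by (simp only: exp_add w_def)
  qed
  then have "quadratic_form X (\<lambda>a b. exp (- (t * s a b))) \<xi> =
      quadratic_form X (\<lambda>a b. exp (t * g a b)) (\<lambda>a. w a * \<xi> a)" for \<xi>
    unfolding quadratic_form_def by (simp add: mult_ac)
  then show ?thesis
    unfolding psd_kernel_def using psd_kernel_exp[OF X tg] sym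
    by (simp add: psd_kernel_def)
qed (simp add: psd_kernel_def quadratic_form_def)

section \<open>Powers of a kernel of negative type\<close>

text \<open>
  The integrand in the representation of the Bernstein function \<open>s powr \<alpha>\<close>, for \<open>0 < \<alpha> < 1\<close>, as a
  mixture of the functions \<open>1 - exp (- t s)\<close>.
\<close>

definition bernstein_integrand :: "real \<Rightarrow> real \<Rightarrow> real \<Rightarrow> real" where
  "bernstein_integrand \<alpha> s t = indicator {0<..} t * ((1 - exp (- (t * s))) * t powr (- 1 - \<alpha>))"

lemma bernstein_integrand_measurable [measurable]:
  "bernstein_integrand \<alpha> s \<in> borel_measurable borel"
  unfolding bernstein_integrand_def by measurable

text \<open>
  Near 0 the bound \<open>1 - exp (- t) \<le> t\<close> leaves the integrable function \<open>t powr (- \<alpha>)\<close>; beyond 1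
  the function \<open>t powr (- 1 - \<alpha>)\<close> is integrable by itself.
\<close>

lemma bernstein_integrand_1_integrable:
  assumes \<alpha>: "0 < \<alpha>" "\<alpha> < 1"
  shows "integrable lborel (bernstein_integrand \<alpha> 1)"
proof -
  have "set_integrable lebesgue {0..1::real} (\<lambda>t. t powr (- \<alpha>))"
    using \<alpha> by (intro nonnegative_absolutely_integrable_1 integrable_on_powr_from_0) auto
  then have 1: "integrable lborel (\<lambda>t. indicator {0..1::real} t * t powr (- \<alpha>))"
    by (simp add: set_integrable_def integrable_completion)
  have "set_integrable lebesgue {1::real..} (\<lambda>t. t powr (- 1 - \<alpha>))"
    using \<alpha> has_integral_powr_to_inf[of "- 1 - \<alpha>" 1]
    by (intro nonnegative_absolutely_integrable_1) auto
  then have 2: "integrable lborel (\<lambda>t. indicator {1::real..} t * t powr (- 1 - \<alpha>))"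
    by (simp add: set_integrable_def integrable_completion)
  have 3: "(1 - exp (- t)) * t powr (- 1 - \<alpha>) \<le> t powr - \<alpha>" if "t > 0" for t
  proof -
    have "(1 - exp (- t)) * t powr (- 1 - \<alpha>) \<le> t * t powr (- 1 - \<alpha>)"
      using exp_ge_add_one_self[of "- t"] by (intro mult_right_mono) auto
    also have "\<dots> = t powr - \<alpha>" using powr_add[of t 1 "- 1 - \<alpha>"] that by simp
    finally show ?thesis .
  qed
  show ?thesis
  proof (rule Bochner_Integration.integrable_bound[OF Bochner_Integration.integrable_add[OF 1 2]])
    show "AE t in lborel. norm (bernstein_integrand \<alpha> 1 t) \<le>
       norm (indicator {0..1} t * t powr - \<alpha> + indicator {1..} t * t powr (- 1 - \<alpha>))"
    proof (rule AE_I2)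
      fix t :: real
      consider "t \<le> 0" | "0 < t" "t \<le> 1" | "1 < t" by linarith
      then show "norm (bernstein_integrand \<alpha> 1 t) \<le>
       norm (indicator {0..1} t * t powr - \<alpha> + indicator {1..} t * t powr (- 1 - \<alpha>))"
      proof cases
        case 2
        moreover have "- 1 \<le> exp (- 1 :: real)" by (rule order_trans[of _ 0]) auto
        ultimately show ?thesis using 3[of t]
          by (auto simp: bernstein_integrand_def indicator_def abs_mult)
      next
        case 3
        then show ?thesis by (auto simp: bernstein_integrand_def mult_le_cancel_right1)
      qed (simp add: bernstein_integrand_def)
    qed
  qed simp
qed

text \<open>
  The substitution of \<open>s * t\<close> for \<open>t\<close> shows that the integral is homogeneous of degree \<open>\<alpha>\<close> in \<open>s\<close>.
\<close>

lemma bernstein_integral: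
  assumes \<alpha>: "0 < \<alpha>" "\<alpha> < 1" and s: "0 \<le> s"
  shows "integrable lborel (bernstein_integrand \<alpha> s)"
    and "(\<integral>t. bernstein_integrand \<alpha> s t \<partial>lborel) =
      (\<integral>t. bernstein_integrand \<alpha> 1 t \<partial>lborel) * s powr \<alpha>"
proof -
  have "integrable lborel (bernstein_integrand \<alpha> s) \<and> (\<integral>t. bernstein_integrand \<alpha> s t \<partial>lborel) =
      (\<integral>t. bernstein_integrand \<alpha> 1 t \<partial>lborel) * s powr \<alpha>"
  proof (cases "s = 0")
    case True
    moreover have "bernstein_integrand \<alpha> 0 = (\<lambda>t. 0)"
      by (simp add: bernstein_integrand_def fun_eq_iff)
    ultimately show ?thesis by simp
  next
    case False
    with s have s: "s > 0" by simp
    have eq: "bernstein_integrand \<alpha> 1 (0 + s * t) = s powr (- 1 - \<alpha>) * bernstein_integrand \<alpha> s t" for t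
      using s by (auto simp: bernstein_integrand_def indicator_def powr_mult zero_less_mult_iff mult_ac)
    have int: "integrable lborel (\<lambda>t. s powr (- 1 - \<alpha>) * bernstein_integrand \<alpha> s t)"
      using lborel_integrable_real_affine[OF bernstein_integrand_1_integrable[OF \<alpha>], of s 0] s
      unfolding eq by simp
    have "(\<integral>t. bernstein_integrand \<alpha> 1 t \<partial>lborel) =
        s * (s powr (- 1 - \<alpha>) * (\<integral>t. bernstein_integrand \<alpha> s t \<partial>lborel))"
      using lborel_integral_real_affine[of s "bernstein_integrand \<alpha> 1" 0] s
      unfolding eq by simp
    also have "s * (s powr (- 1 - \<alpha>) * (\<integral>t. bernstein_integrand \<alpha> s t \<partial>lborel)) * s powr \<alpha> =
       (s powr 1 * s powr (- 1 - \<alpha>) * s powr \<alpha>) * (\<integral>t. bernstein_integrand \<alpha> s t \<partial>lborel)"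
      using s by simp
    also have "s powr 1 * s powr (- 1 - \<alpha>) * s powr \<alpha> = 1"
      unfolding powr_add[symmetric] using s by simp
    finally show ?thesis using int s by simp
  qed
  then show "integrable lborel (bernstein_integrand \<alpha> s)"
    and "(\<integral>t. bernstein_integrand \<alpha> s t \<partial>lborel) =
      (\<integral>t. bernstein_integrand \<alpha> 1 t \<partial>lborel) * s powr \<alpha>" by auto
qed

text \<open>
  For a vector with sum 0, the constant 1 in \<open>1 - exp (- t s)\<close> contributes nothing to the form, so the form of
  the power is a negative mixture of forms of the positive semidefinite kernels \<open>exp (- t s)\<close>.
  As \<open>t\<close> grows, the forms of the latter tend to the squared norm of the vector, because \<open>s\<close> is
  positive off the diagonal; this gives the strictness.
\<close>

lemma neg_type_powr_imp_strict:
  assumes X: "finite X" and sym: "\<And>a b. a \<in> X \<Longrightarrow> b \<in> X \<Longrightarrow> s a b = s b a"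
    and s0: "\<And>a. a \<in> X \<Longrightarrow> s a a = 0"
    and pos: "\<And>a b. a \<in> X \<Longrightarrow> b \<in> X \<Longrightarrow> a \<noteq> b \<Longrightarrow> 0 < s a b"
    and neg: "neg_type X s" and \<alpha>: "0 < \<alpha>" "\<alpha> < 1"
  shows "strict_neg_type X (\<lambda>a b. s a b powr \<alpha>)"
  unfolding strict_neg_type_def
proof (intro allI impI)
  fix \<xi> :: "'a \<Rightarrow> real"
  assume sum0: "(\<Sum>a\<in>X. \<xi> a) = 0" and nz: "\<exists>a\<in>X. \<xi> a \<noteq> 0"
  have s_nonneg: "0 \<le> s a b" if "a \<in> X" "b \<in> X" for a b
    using pos[of a b] s0[of a] that by (cases "a = b") auto
  define C where "C = (\<integral>t. bernstein_integrand \<alpha> 1 t \<partial>lborel)"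
  define E where "E = (\<lambda>t. quadratic_form X (\<lambda>a b. exp (- (t * s a b))) \<xi>)"
  define h where "h = (\<lambda>t. quadratic_form X (\<lambda>a b. bernstein_integrand \<alpha> (s a b) t) \<xi>)"
  have h_eq: "h t = - (indicator {0<..} t * (t powr (- 1 - \<alpha>) * E t))" for t
  proof -
    have "h t = (\<Sum>a\<in>X. \<Sum>b\<in>X. indicator {0<..} t * t powr (- 1 - \<alpha>) * (\<xi> a * \<xi> b)
        - indicator {0<..} t * (t powr (- 1 - \<alpha>) * (exp (- (t * s a b)) * \<xi> a * \<xi> b)))"
      unfolding h_def bernstein_integrand_def quadratic_form_def
      by (intro sum.cong refl) (simp add: algebra_simps)
    also have "\<dots> = (\<Sum>a\<in>X. \<Sum>b\<in>X. indicator {0<..} t * t powr (- 1 - \<alpha>) * (\<xi> a * \<xi> b))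
        - indicator {0<..} t * (t powr (- 1 - \<alpha>) * E t)"
      unfolding E_def quadratic_form_def by (simp add: sum_distrib_left sum_subtractf)
    also have "(\<Sum>a\<in>X. \<Sum>b\<in>X. indicator {0<..} t * t powr (- 1 - \<alpha>) * (\<xi> a * \<xi> b)) = 0"
      by (simp add: sum_distrib_left[symmetric] sum0)
    finally show ?thesis by simp
  qed
  have E_nonneg: "0 \<le> E t" if "0 \<le> t" for t
    using neg_type_imp_psd_kernel_exp[OF X sym s0 neg that] unfolding E_def psd_kernel_def by blast
  have h_le: "h t \<le> 0" for t
    using E_nonneg[of t] by (auto simp: h_eq indicator_def)
  have int: "integrable lborel h"
    unfolding h_def quadratic_form_def
    by (intro Bochner_Integration.integrable_sum integrable_mult_left bernstein_integral \<alpha> s_nonneg)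
  have "integral\<^sup>L lborel h = C * quadratic_form X (\<lambda>a b. s a b powr \<alpha>) \<xi>"
  proof -
    have "integral\<^sup>L lborel h = (\<Sum>a\<in>X. \<Sum>b\<in>X. C * s a b powr \<alpha> * \<xi> a * \<xi> b)"
      unfolding h_def quadratic_form_def
      by (simp add: bernstein_integral[OF \<alpha> s_nonneg] C_def)
    then show ?thesis by (simp add: quadratic_form_def sum_distrib_left mult.assoc)
  qed
  moreover have "integral\<^sup>L lborel h < 0"
  proof -
    have "integral\<^sup>L lborel h \<noteq> 0"
    proof
      assume "integral\<^sup>L lborel h = 0"
      then have "AE t in lborel. h t = 0"
        using integral_nonneg_eq_0_iff_AE[of lborel "\<lambda>t. - h t"] int h_le by auto
      \<comment> \<open>If the integral vanishes, then \<open>E t = 0\<close> for almost all \<open>t > 0\<close>, but \<open>E\<close> has a positive limit.\<close>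
      have "(E \<longlongrightarrow> (\<Sum>a\<in>X. \<Sum>b\<in>X. (if a = b then 1 else 0) * \<xi> a * \<xi> b)) at_top"
        unfolding E_def quadratic_form_def
      proof (intro tendsto_intros)
        fix a b assume ab: "a \<in> X" "b \<in> X"
        show "((\<lambda>t. exp (- (t * s a b))) \<longlongrightarrow> (if a = b then 1 else 0)) at_top"
        proof (cases "a = b")
          case False
          then have "s a b > 0" using pos ab by simp
          then show ?thesis using False by real_asymp
        qed (use s0 ab in simp)
      qed
      also have "(\<Sum>a\<in>X. \<Sum>b\<in>X. (if a = b then 1 else 0) * \<xi> a * \<xi> b) = (\<Sum>a\<in>X. (\<xi> a)\<^sup>2)"
        using X by (simp add: if_distrib if_distribR sum.delta power2_eq_square cong: if_cong)
      finally have "(E \<longlongrightarrow> (\<Sum>a\<in>X. (\<xi> a)\<^sup>2)) at_top" .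
      moreover have "0 < (\<Sum>a\<in>X. (\<xi> a)\<^sup>2)"
        using X nz by (auto intro: sum_pos2)
      ultimately have "eventually (\<lambda>t. 0 < E t) at_top"
        by (rule order_tendstoD)
      then have "eventually (\<lambda>t. 0 < E t \<and> 1 \<le> t) at_top"
        using eventually_ge_at_top[of 1] by (rule eventually_conj)
      then obtain T where T: "\<And>t. t \<ge> T \<Longrightarrow> 0 < E t \<and> 1 \<le> t"
        by (auto simp: eventually_at_top_linorder)
      have "AE t in lborel. t \<notin> {T..T + 1}"
        using \<open>AE t in lborel. h t = 0\<close>
      proof eventually_elim
        case (elim t)
        then show ?case using T[of t] by (auto simp: h_eq)
      qed
      then have "emeasure lborel {T..T + 1} = 0"
        by (subst (asm) AE_iff_null_sets[symmetric]) auto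
      then show False by simp
    qed
    moreover have "integral\<^sup>L lborel h \<le> 0"
      using integral_nonneg_AE[of "\<lambda>t. - h t" lborel] h_le by simp
    ultimately show ?thesis by simp
  qed
  moreover have "0 \<le> C"
    unfolding C_def by (intro integral_nonneg_AE AE_I2) (auto simp: bernstein_integrand_def indicator_def)
  ultimately show "quadratic_form X (\<lambda>a b. s a b powr \<alpha>) \<xi> < 0"
    by (smt (verit) mult_nonneg_nonneg)
qed

section \<open>Generalised roundness as negative type\<close>

text \<open>
  \<open>N\<close> records the multiplicities of the points \<open>y 0, \<dots>, y (k - 1)\<close>. Stating this as a change of
  summation, for all test functions \<open>g\<close>, is the form in which it is applied to double sums.
\<close>

definition counts :: "'a set \<Rightarrow> nat \<Rightarrow> (nat \<Rightarrow> 'a) \<Rightarrow> ('a \<Rightarrow> real) \<Rightarrow> bool" where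
  "counts X k y N \<longleftrightarrow> (\<forall>g :: 'a \<Rightarrow> real. (\<Sum>i<k. g (y i)) = (\<Sum>a\<in>X. N a * g a))"

lemma counts_card:
  assumes "finite X" "\<And>i. i < k \<Longrightarrow> y i \<in> X"
  shows "counts X k y (\<lambda>a. real (card {i. i < k \<and> y i = a}))"
  unfolding counts_def
proof
  fix g :: "'a \<Rightarrow> real"
  have "(\<Sum>i<k. g (y i)) = (\<Sum>a\<in>X. \<Sum>i\<in>{i\<in>{..<k}. y i = a}. g (y i))"
    using assms by (intro sum.group[symmetric]) auto
  also have "\<dots> = (\<Sum>a\<in>X. real (card {i. i < k \<and> y i = a}) * g a)"
    by (intro sum.cong refl) simp
  finally show "(\<Sum>i<k. g (y i)) = (\<Sum>a\<in>X. real (card {i. i < k \<and> y i = a}) * g a)" .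
qed

lemma counts_exists:
  fixes f :: "'a \<Rightarrow> nat"
  assumes "finite X"
  shows "\<exists>y. (\<forall>i<sum f X. y i \<in> X) \<and> counts X (sum f X) y (\<lambda>a. real (f a))"
  using assms
proof (induction X)
  case (insert a X)
  then obtain y where y: "\<And>i. i < sum f X \<Longrightarrow> y i \<in> X"
    "\<And>g :: 'a \<Rightarrow> real. (\<Sum>i<sum f X. g (y i)) = (\<Sum>a\<in>X. real (f a) * g a)"
    unfolding counts_def by blast
  define y' where "y' = (\<lambda>i. if i < sum f X then y i else a)"
  have "(\<Sum>i<sum f (insert a X). g (y' i)) = (\<Sum>b\<in>insert a X. real (f b) * g b)" for g :: "'a \<Rightarrow> real"
  proof -
    have "(\<Sum>i<sum f (insert a X). g (y' i)) =
        (\<Sum>i\<in>{0..<sum f X}. g (y' i)) + (\<Sum>i\<in>{sum f X..<sum f X + f a}. g (y' i))"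
      using insert.hyps by (simp add: lessThan_atLeast0 sum.atLeastLessThan_concat add.commute)
    also have "(\<Sum>i\<in>{0..<sum f X}. g (y' i)) = (\<Sum>i<sum f X. g (y i))"
      by (intro sum.cong) (auto simp: y'_def)
    also have "(\<Sum>i\<in>{sum f X..<sum f X + f a}. g (y' i)) = (\<Sum>i\<in>{sum f X..<sum f X + f a}. g a)"
      by (intro sum.cong) (auto simp: y'_def)
    finally show ?thesis using insert.hyps y(2)[of g] by simp
  qed
  moreover have "\<forall>i<sum f (insert a X). y' i \<in> insert a X"
    using y(1) by (auto simp: y'_def)
  ultimately show ?case unfolding counts_def by blast
qed (simp add: counts_def)

lemma counts_double_sum:
  assumes "counts X k y N" "counts X k z M"
  shows "(\<Sum>i<k. \<Sum>j<k. s (y i) (z j)) = (\<Sum>a\<in>X. \<Sum>b\<in>X. s a b * N a * M b)"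
proof -
  have "(\<Sum>i<k. \<Sum>j<k. s (y i) (z j)) = (\<Sum>i<k. \<Sum>b\<in>X. M b * s (y i) b)"
    using assms(2) by (simp add: counts_def)
  also have "\<dots> = (\<Sum>a\<in>X. N a * (\<Sum>b\<in>X. M b * s a b))"
    using assms(1) unfolding counts_def by (rule allE[where x = "\<lambda>a. \<Sum>b\<in>X. M b * s a b"])
  also have "\<dots> = (\<Sum>a\<in>X. \<Sum>b\<in>X. s a b * N a * M b)"
    by (simp add: sum_distrib_left mult_ac)
  finally show ?thesis .
qed

text \<open>
  The defect in the roundness inequality is the quadratic form at the difference of the multiplicities.
\<close>

lemma roundness_eq_quadratic_form:
  assumes sym: "\<And>a b. a \<in> X \<Longrightarrow> b \<in> X \<Longrightarrow> s a b = s b a"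
    and y: "counts X k y N" and z: "counts X k z M"
  shows "(\<Sum>i<k. \<Sum>j<k. s (y i) (y j) + s (z i) (z j)) - 2 * (\<Sum>i<k. \<Sum>j<k. s (y i) (z j)) =
    quadratic_form X s (\<lambda>a. N a - M a)"
proof -
  have "(\<Sum>a\<in>X. M a * (\<Sum>b\<in>X. s a b * N b)) = (\<Sum>a\<in>X. \<Sum>b\<in>X. s a b * N a * M b)"
    unfolding sum_distrib_left
    by (subst sum.swap) (intro sum.cong refl, simp add: sym)
  then have "quadratic_form X s (\<lambda>a. N a + (- 1) * M a) =
      quadratic_form X s N - 2 * (\<Sum>a\<in>X. \<Sum>b\<in>X. s a b * N a * M b) + quadratic_form X s M"
    by (subst quadratic_form_vec_add[OF sym]) auto
  then show ?thesis
    by (simp add: sum.distrib counts_double_sum[OF y y] counts_double_sum[OF z z]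
        counts_double_sum[OF y z] quadratic_form_def)
qed

lemma floor_mult_div_tendsto: "(\<lambda>N. real_of_int \<lfloor>real N * r\<rfloor> / real N) \<longlonglongrightarrow> r"
proof (rule real_tendsto_sandwich)
  show "\<forall>\<^sub>F N in sequentially. r - 1 / real N \<le> real_of_int \<lfloor>real N * r\<rfloor> / real N"
    using eventually_gt_at_top[of 0]
  proof eventually_elim
    case (elim N)
    have "real N * r - 1 \<le> real_of_int \<lfloor>real N * r\<rfloor>" by linarith
    then have "(real N * r - 1) / real N \<le> real_of_int \<lfloor>real N * r\<rfloor> / real N"
      by (rule divide_right_mono) simp
    then show ?case using elim by (simp add: diff_divide_distrib)
  qed
  show "\<forall>\<^sub>F N in sequentially. real_of_int \<lfloor>real N * r\<rfloor> / real N \<le> r"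
    using eventually_gt_at_top[of 0]
  proof eventually_elim
    case (elim N)
    have "real_of_int \<lfloor>real N * r\<rfloor> \<le> real N * r" by linarith
    then show ?case using elim by (simp add: field_simps)
  qed
  show "(\<lambda>N. r - 1 / real N) \<longlonglongrightarrow> r"
    using tendsto_diff[OF tendsto_const lim_1_over_n, of r] by simp
qed simp

text \<open>
  A real vector with sum 0 is a limit of rational ones with sum 0, and the form is homogeneous.
\<close>

lemma neg_type_iff_integer:
  assumes X: "finite X"
  shows "neg_type X s \<longleftrightarrow>
    (\<forall>w :: 'a \<Rightarrow> int. sum w X = 0 \<longrightarrow> quadratic_form X s (\<lambda>a. real_of_int (w a)) \<le> 0)"
proof
  assume neg: "neg_type X s"
  show "\<forall>w :: 'a \<Rightarrow> int. sum w X = 0 \<longrightarrow> quadratic_form X s (\<lambda>a. real_of_int (w a)) \<le> 0"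
  proof (intro allI impI)
    fix w :: "'a \<Rightarrow> int" assume "sum w X = 0"
    then have "(\<Sum>a\<in>X. real_of_int (w a)) = 0" by (simp flip: of_int_sum)
    then show "quadratic_form X s (\<lambda>a. real_of_int (w a)) \<le> 0"
      using neg unfolding neg_type_def by blast
  qed
next
  assume int: "\<forall>w :: 'a \<Rightarrow> int. sum w X = 0 \<longrightarrow> quadratic_form X s (\<lambda>a. real_of_int (w a)) \<le> 0"
  show "neg_type X s" unfolding neg_type_def
  proof (intro allI impI)
    fix \<xi> :: "'a \<Rightarrow> real" assume sum0: "sum \<xi> X = 0"
    show "quadratic_form X s \<xi> \<le> 0"
    proof (cases "X = {}")
      case False
      then obtain c where c: "c \<in> X" by blast
      \<comment> \<open>Round the multiple \<open>N * \<xi>\<close> down, and let one coordinate restore the sum 0.\<close>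
      define w where "w = (\<lambda>N a. if a = c then - (\<Sum>b\<in>X - {c}. \<lfloor>real N * \<xi> b\<rfloor>) else \<lfloor>real N * \<xi> a\<rfloor>)"
      have w0: "sum (w N) X = 0" for N
        using X c by (simp add: sum.remove[of X c] w_def)
      have lim: "(\<lambda>N. real_of_int (w N a) / real N) \<longlonglongrightarrow> \<xi> a" for a
      proof (cases "a = c")
        case True
        have "(\<lambda>N. - (\<Sum>b\<in>X - {c}. real_of_int \<lfloor>real N * \<xi> b\<rfloor> / real N)) \<longlonglongrightarrow> - (\<Sum>b\<in>X - {c}. \<xi> b)"
          by (intro tendsto_intros floor_mult_div_tendsto)
        also have "- (\<Sum>b\<in>X - {c}. \<xi> b) = \<xi> c"
          using sum0 X c by (simp add: sum.remove[of X c])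
        finally show ?thesis using True by (simp add: w_def sum_divide_distrib)
      qed (use floor_mult_div_tendsto in \<open>simp add: w_def\<close>)
      have "(\<lambda>N. quadratic_form X s (\<lambda>a. real_of_int (w N a) / real N)) \<longlonglongrightarrow> quadratic_form X s \<xi>"
        unfolding quadratic_form_def by (intro tendsto_intros lim)
      moreover have "quadratic_form X s (\<lambda>a. real_of_int (w N a) / real N) \<le> 0" for N
      proof -
        have "quadratic_form X s (\<lambda>a. (1 / real N) * real_of_int (w N a)) \<le> 0"
          unfolding quadratic_form_scale using int w0 by (simp add: mult_nonneg_nonpos)
        then show ?thesis by simp
      qed
      ultimately show ?thesis
        by (intro LIMSEQ_le_const2) auto
    qed (simp add: quadratic_form_def)
  qed
qed

text \<open>
  The equivalence of Lennard, Tonge and Weston, for finite spaces. An integer vector with sum 0 is the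
  difference of the multiplicities given by its positive and negative parts; these have equal size.
\<close>

lemma generalised_roundness_iff_neg_type:
  assumes X: "finite X" and sym: "\<And>a b. a \<in> X \<Longrightarrow> b \<in> X \<Longrightarrow> d a b = d b a"
  shows "generalised_roundness X d p \<longleftrightarrow> neg_type X (\<lambda>a b. d a b powr p)"
proof -
  define s where "s = (\<lambda>a b. d a b powr p)"
  have sym': "\<And>a b. a \<in> X \<Longrightarrow> b \<in> X \<Longrightarrow> s a b = s b a"
    using sym by (simp add: s_def)
  have "generalised_roundness X d p \<longleftrightarrow> neg_type X s"
  proof
    assume neg: "neg_type X s"
    show "generalised_roundness X d p" unfolding generalised_roundness_def
    proof (intro allI impI)
      fix k :: nat and y z assume yz: "\<forall>i<k. y i \<in> X \<and> z i \<in> X"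
      define N where "N = (\<lambda>y a. real (card {i. i < k \<and> y i = (a :: 'a)}))"
      have y: "counts X k y (N y)" and z: "counts X k z (N z)"
        using counts_card[OF X] yz by (simp_all add: N_def)
      have "(\<Sum>a\<in>X. N y a - N z a) = 0"
        using y[unfolded counts_def, rule_format, of "\<lambda>_. 1"]
          z[unfolded counts_def, rule_format, of "\<lambda>_. 1"] by (simp add: sum_subtractf)
      then have "quadratic_form X s (\<lambda>a. N y a - N z a) \<le> 0"
        using neg unfolding neg_type_def by blast
      then show "(\<Sum>i<k. \<Sum>j<k. d (y i) (y j) powr p + d (z i) (z j) powr p)
          \<le> 2 * (\<Sum>i<k. \<Sum>j<k. d (y i) (z j) powr p)"
        using roundness_eq_quadratic_form[of X s, OF sym' y z] by (simp add: s_def)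
    qed
  next
    assume gr: "generalised_roundness X d p"
    show "neg_type X s" unfolding neg_type_iff_integer[OF X]
    proof (intro allI impI)
      fix w :: "'a \<Rightarrow> int" assume w: "sum w X = 0"
      define k where "k = (\<Sum>a\<in>X. nat (w a))"
      have "int (\<Sum>a\<in>X. nat (w a)) - int (\<Sum>a\<in>X. nat (- w a)) = (\<Sum>a\<in>X. w a)"
        unfolding of_nat_sum sum_subtractf[symmetric] by (intro sum.cong) auto
      then have k: "(\<Sum>a\<in>X. nat (- w a)) = k"
        unfolding w k_def by (simp only: right_minus_eq of_nat_eq_iff)
      obtain y where y: "\<forall>i<k. y i \<in> X" "counts X k y (\<lambda>a. real (nat (w a)))"
        using counts_exists[OF X, of "\<lambda>a. nat (w a)"] unfolding k_def by blast
      obtain z where z: "\<forall>i<k. z i \<in> X" "counts X k z (\<lambda>a. real (nat (- w a)))"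
        using counts_exists[OF X, of "\<lambda>a. nat (- w a)"] unfolding k by blast
      have "(\<Sum>i<k. \<Sum>j<k. s (y i) (y j) + s (z i) (z j)) \<le> 2 * (\<Sum>i<k. \<Sum>j<k. s (y i) (z j))"
        using gr y(1) z(1) unfolding generalised_roundness_def s_def by blast
      then have "quadratic_form X s (\<lambda>a. real (nat (w a)) - real (nat (- w a))) \<le> 0"
        using roundness_eq_quadratic_form[of X s, OF sym' y(2) z(2)] by linarith
      also have "(\<lambda>a. real (nat (w a)) - real (nat (- w a))) = (\<lambda>a. real_of_int (w a))"
        by (auto simp: fun_eq_iff)
      finally show "quadratic_form X s (\<lambda>a. real_of_int (w a)) \<le> 0" .
    qed
  qed
  then show ?thesis by (simp add: s_def)
qed

lemma neg_type_image_iff: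
  assumes "inj_on x I"
  shows "neg_type (x ` I) s \<longleftrightarrow> neg_type I (\<lambda>i j. s (x i) (x j))"
proof -
  have sum_eq: "sum \<xi> (x ` I) = sum (\<xi> \<circ> x) I"
    and form_eq: "quadratic_form (x ` I) s \<xi> = quadratic_form I (\<lambda>i j. s (x i) (x j)) (\<xi> \<circ> x)" for \<xi>
    using assms by (simp_all add: quadratic_form_def sum.reindex)
  show ?thesis
  proof
    assume neg: "neg_type (x ` I) s"
    show "neg_type I (\<lambda>i j. s (x i) (x j))" unfolding neg_type_def
    proof (intro allI impI)
      fix \<zeta> :: "'a \<Rightarrow> real" assume sum0: "sum \<zeta> I = 0"
      define \<xi> where "\<xi> = \<zeta> \<circ> inv_into I x"
      have \<xi>: "(\<xi> \<circ> x) i = \<zeta> i" if "i \<in> I" for i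
        using assms that by (simp add: \<xi>_def)
      have "sum \<xi> (x ` I) = 0"
        unfolding sum_eq using \<xi> sum0 by (simp cong: sum.cong)
      then have "quadratic_form (x ` I) s \<xi> \<le> 0"
        using neg unfolding neg_type_def by blast
      also have "quadratic_form (x ` I) s \<xi> = quadratic_form I (\<lambda>i j. s (x i) (x j)) \<zeta>"
        unfolding form_eq by (intro quadratic_form_cong refl \<xi>)
      finally show "quadratic_form I (\<lambda>i j. s (x i) (x j)) \<zeta> \<le> 0" .
    qed
  qed (auto simp: neg_type_def sum_eq form_eq)
qed

section \<open>Stability of strict negative type\<close>

text \<open>
  On the compact unit sphere of the sum-zero vectors the form stays below some \<open>- \<delta>\<close>. Small changes
  of the kernel move it by less than \<open>\<delta>\<close> there, and homogeneity extends the sign to all vectors.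
\<close>

lemma strict_neg_type_eventually:
  fixes S :: "'b \<Rightarrow> 'a \<Rightarrow> 'a \<Rightarrow> real"
  assumes X: "finite X" and strict: "strict_neg_type X s"
    and lim: "\<And>a b. a \<in> X \<Longrightarrow> b \<in> X \<Longrightarrow> ((\<lambda>p. S p a b) \<longlongrightarrow> s a b) F"
  shows "eventually (\<lambda>p. strict_neg_type X (S p)) F"
proof -
  \<comment> \<open>The cube bounds also the coordinates outside \<open>X\<close>, on which the form does not depend, so that \<open>K\<close>
    is compact in the product topology by the theorem of Tychonoff.\<close>
  define K where "K = Pi\<^sub>E UNIV (\<lambda>_. {- 1..1 :: real}) \<inter> {\<xi>. (\<Sum>a\<in>X. \<xi> a) = 0} \<inter> {\<xi>. (\<Sum>a\<in>X. (\<xi> a)\<^sup>2) = 1}"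
  have coord: "continuous_on A (\<lambda>\<xi>. \<xi> a)" for A :: "('a \<Rightarrow> real) set" and a
    by (rule continuous_on_subset[OF continuous_on_product_coordinates]) auto
  have "compact (Pi\<^sub>E UNIV (\<lambda>_ :: 'a. {- 1..1 :: real}))"
    using compactin_PiE[of "\<lambda>_ :: 'a. euclidean :: real topology" UNIV "\<lambda>_. {- 1..1}"]
    by (simp add: euclidean_product_topology)
  moreover have "closed {\<xi> :: 'a \<Rightarrow> real. (\<Sum>a\<in>X. \<xi> a) = 0}"
    by (intro closed_Collect_eq continuous_intros coord)
  moreover have "closed {\<xi> :: 'a \<Rightarrow> real. (\<Sum>a\<in>X. (\<xi> a)\<^sup>2) = 1}"
    by (intro closed_Collect_eq continuous_intros coord)
  ultimately have K: "compact K"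
    unfolding K_def by (intro compact_Int_closed)
  have neg: "quadratic_form X s \<xi> < 0" if "\<xi> \<in> K" for \<xi>
  proof -
    have "\<exists>a\<in>X. \<xi> a \<noteq> 0"
    proof (rule ccontr)
      assume "\<not> (\<exists>a\<in>X. \<xi> a \<noteq> 0)"
      then have "(\<Sum>a\<in>X. (\<xi> a)\<^sup>2) = 0" by simp
      then show False using that by (simp add: K_def)
    qed
    then show ?thesis using strict that unfolding strict_neg_type_def K_def by blast
  qed
  have "\<exists>\<delta>>0. \<forall>\<xi>\<in>K. quadratic_form X s \<xi> \<le> - \<delta>"
  proof (cases "K = {}")
    case False
    have "continuous_on K (quadratic_form X s)"
      unfolding quadratic_form_def by (intro continuous_intros coord)
    then obtain \<xi>0 where "\<xi>0 \<in> K" "\<forall>\<xi>\<in>K. quadratic_form X s \<xi> \<le> quadratic_form X s \<xi>0"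
      using continuous_attains_sup[OF K False] by blast
    then show ?thesis using neg[of \<xi>0] by (intro exI[of _ "- quadratic_form X s \<xi>0"]) auto
  qed (auto intro: exI[of _ 1])
  then obtain \<delta> where \<delta>: "\<delta> > 0" "\<And>\<xi>. \<xi> \<in> K \<Longrightarrow> quadratic_form X s \<xi> \<le> - \<delta>" by blast
  have "((\<lambda>p. \<Sum>a\<in>X. \<Sum>b\<in>X. \<bar>S p a b - s a b\<bar>) \<longlongrightarrow> (\<Sum>a\<in>X. \<Sum>b\<in>X. \<bar>s a b - s a b\<bar>)) F"
    by (intro tendsto_intros lim)
  then have "eventually (\<lambda>p. (\<Sum>a\<in>X. \<Sum>b\<in>X. \<bar>S p a b - s a b\<bar>) < \<delta>) F"
    using \<delta>(1) by (intro order_tendstoD(2)) auto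
  then show ?thesis
  proof eventually_elim
    case (elim p)
    have onK: "quadratic_form X (S p) \<xi> < 0" if \<xi>: "\<xi> \<in> K" for \<xi>
    proof -
      have b: "\<bar>\<xi> a\<bar> \<le> 1" for a
        using \<xi> by (auto simp: K_def PiE_iff abs_le_iff minus_le_iff)
      have "quadratic_form X (S p) \<xi> - quadratic_form X s \<xi> =
          (\<Sum>a\<in>X. \<Sum>b\<in>X. (S p a b - s a b) * (\<xi> a * \<xi> b))"
        unfolding quadratic_form_def by (simp add: sum_subtractf algebra_simps)
      also have "\<dots> \<le> (\<Sum>a\<in>X. \<Sum>b\<in>X. \<bar>S p a b - s a b\<bar>)"
      proof (intro sum_mono)
        fix a b
        have "(S p a b - s a b) * (\<xi> a * \<xi> b) \<le> \<bar>S p a b - s a b\<bar> * (\<bar>\<xi> a\<bar> * \<bar>\<xi> b\<bar>)"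
          unfolding abs_mult[symmetric] by simp
        also have "\<dots> \<le> \<bar>S p a b - s a b\<bar> * (1 * 1)"
          by (intro mult_left_mono mult_mono b) auto
        finally show "(S p a b - s a b) * (\<xi> a * \<xi> b) \<le> \<bar>S p a b - s a b\<bar>" by simp
      qed
      finally show ?thesis using elim \<delta>(2)[OF \<xi>] by linarith
    qed
    show ?case unfolding strict_neg_type_def
    proof (intro allI impI)
      fix \<xi> :: "'a \<Rightarrow> real" assume sum0: "sum \<xi> X = 0" and nz: "\<exists>a\<in>X. \<xi> a \<noteq> 0"
      define r where "r = sqrt (\<Sum>a\<in>X. (\<xi> a)\<^sup>2)"
      have r2: "r\<^sup>2 = (\<Sum>a\<in>X. (\<xi> a)\<^sup>2)" unfolding r_def by (simp add: sum_nonneg)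
      have "0 < (\<Sum>a\<in>X. (\<xi> a)\<^sup>2)" using X nz by (auto intro: sum_pos2)
      then have r: "r > 0" unfolding r_def by simp
      define \<zeta> where "\<zeta> = (\<lambda>a. if a \<in> X then \<xi> a / r else 0)"
      have "(\<Sum>a\<in>X. \<zeta> a) = 0"
        using sum0 by (simp add: \<zeta>_def sum_divide_distrib[symmetric])
      moreover have z2: "(\<Sum>a\<in>X. (\<zeta> a)\<^sup>2) = 1"
        using r by (simp add: \<zeta>_def power_divide r2[symmetric] flip: sum_divide_distrib)
      moreover have "\<zeta> a \<in> {- 1..1}" for a
      proof (cases "a \<in> X")
        case True
        then have "(\<zeta> a)\<^sup>2 \<le> 1"
          using member_le_sum[of a X "\<lambda>a. (\<zeta> a)\<^sup>2"] X z2 by simp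
        then show ?thesis by (simp add: abs_square_le_1 abs_le_iff minus_le_iff)
      qed (simp add: \<zeta>_def)
      ultimately have "\<zeta> \<in> K" by (auto simp: K_def PiE_iff)
      have "quadratic_form X (S p) \<xi> = quadratic_form X (S p) (\<lambda>a. r * \<zeta> a)"
        using r by (intro quadratic_form_cong) (simp_all add: \<zeta>_def)
      also have "\<dots> < 0"
        unfolding quadratic_form_scale using r onK[OF \<open>\<zeta> \<in> K\<close>] by (simp add: mult_pos_neg)
      finally show "quadratic_form X (S p) \<xi> < 0" .
    qed
  qed
qed

text \<open>
  The case \<open>r = 0\<close> is included because \<open>0 powr p = 0\<close> for all \<open>p\<close>, also for \<open>p = 0\<close>.
\<close>

lemma tendsto_powr_exponent:
  fixes r :: real
  shows "((\<lambda>p. r powr p) \<longlongrightarrow> r powr q) (at q within A)"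
proof (cases "r = 0")
  case False
  then show ?thesis by (intro tendsto_intros) auto
qed simp

section \<open>Constant potentials\<close>

text \<open>
  The degeneracy that both determinants detect: \<open>s\<close> restricted to the sum-zero vectors, as a bilinear form, has a
  nontrivial kernel.
\<close>

definition has_constant_potential :: "'a set \<Rightarrow> ('a \<Rightarrow> 'a \<Rightarrow> real) \<Rightarrow> bool" where
  "has_constant_potential X s \<longleftrightarrow> (\<exists>\<xi> c. (\<exists>a\<in>X. \<xi> a \<noteq> 0) \<and> (\<Sum>a\<in>X. \<xi> a) = 0 \<and>
     (\<forall>a\<in>X. (\<Sum>b\<in>X. s a b * \<xi> b) = c))"

lemma quadratic_form_potential:
  "quadratic_form X s \<xi> = (\<Sum>a\<in>X. \<xi> a * (\<Sum>b\<in>X. s a b * \<xi> b))"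
  unfolding quadratic_form_def by (simp add: sum_distrib_left mult_ac)

lemma strict_neg_type_no_constant_potential:
  assumes "strict_neg_type X s"
  shows "\<not> has_constant_potential X s"
proof
  assume "has_constant_potential X s"
  then obtain \<xi> c where \<xi>: "\<exists>a\<in>X. \<xi> a \<noteq> 0" "sum \<xi> X = 0"
    "\<And>a. a \<in> X \<Longrightarrow> (\<Sum>b\<in>X. s a b * \<xi> b) = c"
    unfolding has_constant_potential_def by blast
  have "quadratic_form X s \<xi> = sum \<xi> X * c"
    unfolding quadratic_form_potential sum_distrib_right by (intro sum.cong) (simp_all add: \<xi>)
  then show False using assms \<xi>(1,2) unfolding strict_neg_type_def by force
qed

lemma quadratic_nonpos_imp_slope_zero:
  fixes c k :: real
  assumes "\<And>t. 2 * t * c + t\<^sup>2 * k \<le> 0"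
  shows "c = 0"
proof (rule ccontr)
  assume "c \<noteq> 0"
  \<comment> \<open>At \<open>t = c / m\<close> the linear term dominates the quadratic one.\<close>
  define m where "m = \<bar>k\<bar> + 1"
  have m: "m > 0" "k \<ge> - m" unfolding m_def by auto
  have "2 * (c / m) * c + (c / m)\<^sup>2 * k = (c / m)\<^sup>2 * (2 * m + k)"
    using m by (simp add: field_simps power2_eq_square)
  moreover have "(c / m)\<^sup>2 * (2 * m + k) > 0"
    using \<open>c \<noteq> 0\<close> m by (intro mult_pos_pos) auto
  ultimately show False using assms[of "c / m"] by linarith
qed

text \<open>
  A sum-zero vector with form value 0 maximises the form among the sum-zero vectors. The derivative of
  the form therefore vanishes in the directions \<open>e a - e c\<close>, which says that the potential takes
  the same value at \<open>a\<close> and \<open>c\<close>.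
\<close>

lemma degenerate_neg_type_has_constant_potential:
  assumes X: "finite X" and sym: "\<And>a b. a \<in> X \<Longrightarrow> b \<in> X \<Longrightarrow> s a b = s b a"
    and neg: "neg_type X s" and deg: "\<not> strict_neg_type X s"
  shows "has_constant_potential X s"
proof -
  obtain \<xi> where \<xi>: "sum \<xi> X = 0" "\<exists>a\<in>X. \<xi> a \<noteq> 0" "quadratic_form X s \<xi> = 0"
    using neg deg unfolding neg_type_def strict_neg_type_def by (meson linorder_not_less order_antisym)
  then obtain c where c: "c \<in> X" by blast
  define \<phi> where "\<phi> = (\<lambda>a. \<Sum>b\<in>X. s a b * \<xi> b)"
  have "\<phi> a = \<phi> c" if a: "a \<in> X" for a
  proof -
    define \<eta> where "\<eta> = (\<lambda>b. (if b = a then 1 else 0) - (if b = c then 1 else (0 :: real)))"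
    have \<eta>: "(\<Sum>b\<in>X. \<eta> b * f b) = f a - f c" for f :: "'a \<Rightarrow> real"
    proof -
      have "(\<Sum>b\<in>X. \<eta> b * f b) = (\<Sum>b\<in>X. (if b = a then f b else 0) - (if b = c then f b else 0))"
        by (intro sum.cong) (auto simp: \<eta>_def)
      then show ?thesis using X a c by (simp add: sum_subtractf)
    qed
    have "2 * t * (\<phi> a - \<phi> c) + t\<^sup>2 * quadratic_form X s \<eta> \<le> 0" for t
    proof -
      have "(\<Sum>b\<in>X. \<xi> b + t * \<eta> b) = 0"
        using \<eta>[of "\<lambda>_. 1"] \<xi>(1) by (simp add: sum.distrib flip: sum_distrib_left)
      then have "quadratic_form X s (\<lambda>b. \<xi> b + t * \<eta> b) \<le> 0"
        using neg unfolding neg_type_def by blast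
      then show ?thesis
        using \<xi>(3) \<eta>[of \<phi>] by (simp add: quadratic_form_vec_add[OF sym] \<phi>_def)
    qed
    then have "\<phi> a - \<phi> c = 0" by (rule quadratic_nonpos_imp_slope_zero)
    then show ?thesis by simp
  qed
  then show ?thesis using \<xi>(1,2) unfolding has_constant_potential_def \<phi>_def by blast
qed

section \<open>Cayley-Menger and Gramian determinants\<close>

lemma cayley_menger_mat_carrier: "cayley_menger_mat d x n p \<in> carrier_mat (n + 2) (n + 2)"
  by (auto simp: cayley_menger_mat_def distance_mat_def)

lemma cayley_menger_mat_mult_vec:
  assumes v: "v \<in> carrier_vec (n + 2)"
  shows "vec_index (cayley_menger_mat d x n p *\<^sub>v v) 0 = (\<Sum>j\<le>n. vec_index v (Suc j))"
    and "i \<le> n \<Longrightarrow> vec_index (cayley_menger_mat d x n p *\<^sub>v v) (Suc i) =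
      vec_index v 0 + (\<Sum>j\<le>n. d (x i) (x j) powr p * vec_index v (Suc j))"
proof -
  let ?M = "cayley_menger_mat d x n p"
  have entries: "?M $$ (0, 0) = 0" "\<And>j. j \<le> n \<Longrightarrow> ?M $$ (0, Suc j) = 1"
    "\<And>i. i \<le> n \<Longrightarrow> ?M $$ (Suc i, 0) = 1"
    "\<And>i j. i \<le> n \<Longrightarrow> j \<le> n \<Longrightarrow> ?M $$ (Suc i, Suc j) = d (x i) (x j) powr p"
    by (simp_all add: cayley_menger_mat_def distance_mat_def)
  have "vec_index (?M *\<^sub>v v) k = ?M $$ (k, 0) * vec_index v 0 + (\<Sum>j\<le>n. ?M $$ (k, Suc j) * vec_index v (Suc j))"
    if "k < n + 2" for k
  proof -
    have "vec_index (?M *\<^sub>v v) k = (\<Sum>j<Suc (Suc n). ?M $$ (k, j) * vec_index v j)"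
      using that v cayley_menger_mat_carrier[of d x n p]
      by (auto simp: scalar_prod_def atLeast0LessThan intro!: sum.cong)
    then show ?thesis by (simp only: lessThan_Suc_atMost sum.atMost_Suc_shift)
  qed
  from this[of 0] this[of "Suc i"]
  show "vec_index (?M *\<^sub>v v) 0 = (\<Sum>j\<le>n. vec_index v (Suc j))"
    and "i \<le> n \<Longrightarrow> vec_index (?M *\<^sub>v v) (Suc i) =
      vec_index v 0 + (\<Sum>j\<le>n. d (x i) (x j) powr p * vec_index v (Suc j))"
    by (simp_all add: entries)
qed

text \<open>
  A kernel vector consists of minus the constant, at index 0, followed by the vector with that constant potential;
  row 0 is the condition that this vector has sum 0.
\<close>

lemma det_cayley_menger_mat_eq_0_iff:
  "det (cayley_menger_mat d x n p) = 0 \<longleftrightarrow>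
    has_constant_potential {..n} (\<lambda>i j. d (x i) (x j) powr p)"
proof -
  let ?M = "cayley_menger_mat d x n p"
  note M = cayley_menger_mat_carrier[of d x n p]
  have kernel: "?M *\<^sub>v v = 0\<^sub>v (n + 2) \<longleftrightarrow> (\<Sum>j\<le>n. vec_index v (Suc j)) = 0 \<and>
      (\<forall>i\<le>n. (\<Sum>j\<le>n. d (x i) (x j) powr p * vec_index v (Suc j)) = - vec_index v 0)"
    if v: "v \<in> carrier_vec (n + 2)" for v
  proof -
    have "?M *\<^sub>v v = 0\<^sub>v (n + 2) \<longleftrightarrow> (\<forall>i<Suc (Suc n). vec_index (?M *\<^sub>v v) i = 0)"
      using M by (simp add: Matrix.vec_eq_iff del: index_mult_mat_vec)
    also have "\<dots> \<longleftrightarrow> vec_index (?M *\<^sub>v v) 0 = 0 \<and> (\<forall>i\<le>n. vec_index (?M *\<^sub>v v) (Suc i) = 0)"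
      unfolding All_less_Suc2 less_Suc_eq_le[symmetric] by simp
    finally show ?thesis
      by (simp add: cayley_menger_mat_mult_vec[OF v] add_eq_0_iff del: index_mult_mat_vec)
  qed
  show ?thesis
  proof
    assume "det ?M = 0"
    then obtain v where v: "v \<in> carrier_vec (n + 2)" "v \<noteq> 0\<^sub>v (n + 2)" "?M *\<^sub>v v = 0\<^sub>v (n + 2)"
      using det_0_iff_vec_prod_zero[OF M] by blast
    note ker = kernel[OF v(1), THEN iffD1, OF v(3)]
    have "\<exists>j\<le>n. vec_index v (Suc j) \<noteq> 0"
    proof (rule ccontr)
      assume "\<not> ?thesis"
      then have z: "\<And>j. j \<le> n \<Longrightarrow> vec_index v (Suc j) = 0" by blast
      have "(\<Sum>j\<le>n. d (x 0) (x j) powr p * vec_index v (Suc j)) = - vec_index v 0"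
        using ker by blast
      with z have "vec_index v 0 = 0" by simp
      with z have "v = 0\<^sub>v (n + 2)"
        using v(1) by (intro eq_vecI) (auto simp: less_Suc_eq_0_disj)
      with v(2) show False by simp
    qed
    then show "has_constant_potential {..n} (\<lambda>i j. d (x i) (x j) powr p)"
      unfolding has_constant_potential_def using ker
      by (intro exI[of _ "\<lambda>j. vec_index v (Suc j)"] exI[of _ "- vec_index v 0"]) auto
  next
    assume "has_constant_potential {..n} (\<lambda>i j. d (x i) (x j) powr p)"
    then obtain \<xi> c where \<xi>: "\<exists>i\<le>n. \<xi> i \<noteq> 0" "sum \<xi> {..n} = 0"
      "\<And>i. i \<le> n \<Longrightarrow> (\<Sum>j\<le>n. d (x i) (x j) powr p * \<xi> j) = c"
      unfolding has_constant_potential_def by auto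
    define v where "v = Matrix.vec (n + 2) (\<lambda>k. case k of 0 \<Rightarrow> - c | Suc j \<Rightarrow> \<xi> j)"
    have v: "v \<in> carrier_vec (n + 2)" "vec_index v 0 = - c" "\<And>j. j \<le> n \<Longrightarrow> vec_index v (Suc j) = \<xi> j"
      by (simp_all add: v_def)
    have "?M *\<^sub>v v = 0\<^sub>v (n + 2)"
      unfolding kernel[OF v(1)] using \<xi> v by simp
    moreover have "v \<noteq> 0\<^sub>v (n + 2)"
    proof
      assume "v = 0\<^sub>v (n + 2)"
      then have "\<And>j. j \<le> n \<Longrightarrow> vec_index v (Suc j) = 0" by simp
      then show False using \<xi>(1) v(3) by auto
    qed
    ultimately show "det ?M = 0"
      using det_0_iff_vec_prod_zero[OF M] v(1) by blast
  qed
qed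

text \<open>
  A vector \<open>u\<close> on the points other than \<open>x 0\<close> extends uniquely to a vector with sum 0. The Gramian then
  computes, up to the factor \<open>- 2\<close>, the differences of the potential from its value at \<open>x 0\<close>.
\<close>

lemma det_gramian_mat_eq_0_iff:
  assumes sym: "\<And>i j. i \<le> n \<Longrightarrow> j \<le> n \<Longrightarrow> d (x i) (x j) = d (x j) (x i)"
    and zero: "d (x 0) (x 0) = 0"
  shows "det (gramian_mat d x n p) = 0 \<longleftrightarrow>
    has_constant_potential {..n} (\<lambda>i j. d (x i) (x j) powr p)"
proof -
  let ?G = "gramian_mat d x n p"
  define s where "s = (\<lambda>i j. d (x i) (x j) powr p)"
  have G: "?G \<in> carrier_mat n n" by (auto simp: gramian_mat_def)
  have potential: "(\<Sum>j\<le>n. s (Suc i) j * \<xi> j) - (\<Sum>j\<le>n. s 0 j * \<xi> j) = - 2 * vec_index (?G *\<^sub>v u) i"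
    if u: "u \<in> carrier_vec n" and \<xi>: "sum \<xi> {..n} = 0" "\<And>j. j < n \<Longrightarrow> \<xi> (Suc j) = vec_index u j"
      and i: "i < n" for u \<xi> i
  proof -
    have \<xi>0: "\<xi> 0 = - (\<Sum>j<n. vec_index u j)"
      using \<xi> by (simp add: sum.atMost_shift)
    have "2 * vec_index (?G *\<^sub>v u) i =
        (\<Sum>j<n. (s (Suc i) 0 + s (Suc j) 0 - s (Suc i) (Suc j)) * vec_index u j)"
      using u i by (simp add: gramian_mat_def scalar_prod_def s_def atLeast0LessThan sum_distrib_left)
    also have "\<dots> = (\<Sum>j<n. s (Suc i) 0 * vec_index u j + s 0 (Suc j) * vec_index u j
        - s (Suc i) (Suc j) * vec_index u j)"
      by (intro sum.cong refl) (simp add: s_def sym[of 0] left_diff_distrib distrib_right)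
    also have "\<dots> = - s (Suc i) 0 * \<xi> 0 + (\<Sum>j<n. s 0 (Suc j) * vec_index u j)
        - (\<Sum>j<n. s (Suc i) (Suc j) * vec_index u j)"
      unfolding \<xi>0 by (simp add: sum.distrib sum_subtractf sum_distrib_left sum_negf)
    also have "\<dots> = (\<Sum>j\<le>n. s 0 j * \<xi> j) - (\<Sum>j\<le>n. s (Suc i) j * \<xi> j)"
      using \<xi>(2) zero by (simp add: sum.atMost_shift s_def)
    finally show ?thesis by simp
  qed
  have "det ?G = 0 \<longleftrightarrow> has_constant_potential {..n} s"
  proof
    assume "det ?G = 0"
    then obtain u where u: "u \<in> carrier_vec n" "u \<noteq> 0\<^sub>v n" "?G *\<^sub>v u = 0\<^sub>v n"
      using det_0_iff_vec_prod_zero[OF G] by blast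
    define \<xi> where "\<xi> = (\<lambda>k. case k of 0 \<Rightarrow> - (\<Sum>j<n. vec_index u j) | Suc j \<Rightarrow> vec_index u j)"
    have \<xi>: "sum \<xi> {..n} = 0" "\<And>j. \<xi> (Suc j) = vec_index u j"
      by (simp_all add: \<xi>_def sum.atMost_shift)
    have "\<exists>j<n. vec_index u j \<noteq> 0"
      using u(1,2) by (metis carrier_vecD eq_vecI index_zero_vec)
    then have "\<exists>j\<le>n. \<xi> j \<noteq> 0" using \<xi>(2) by (metis Suc_leI)
    moreover have "(\<Sum>j\<le>n. s i j * \<xi> j) = (\<Sum>j\<le>n. s 0 j * \<xi> j)" if "i \<le> n" for i
      using potential[OF u(1) \<xi>(1) \<xi>(2)] u(3) that by (cases i) auto
    ultimately show "has_constant_potential {..n} s"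
      unfolding has_constant_potential_def using \<xi>(1) by blast
  next
    assume "has_constant_potential {..n} s"
    then obtain \<xi> c where \<xi>: "\<exists>i\<le>n. \<xi> i \<noteq> 0" "sum \<xi> {..n} = 0"
      "\<And>i. i \<le> n \<Longrightarrow> (\<Sum>j\<le>n. s i j * \<xi> j) = c"
      unfolding has_constant_potential_def by auto
    define u where "u = Matrix.vec n (\<lambda>j. \<xi> (Suc j))"
    have u: "u \<in> carrier_vec n" "\<And>j. j < n \<Longrightarrow> \<xi> (Suc j) = vec_index u j"
      by (simp_all add: u_def)
    have "vec_index (?G *\<^sub>v u) i = 0" if "i < n" for i
      using potential[OF u(1) \<xi>(2) u(2) that] \<xi>(3)[of "Suc i"] \<xi>(3)[of 0] that by simp
    then have "?G *\<^sub>v u = 0\<^sub>v n"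
      using G by (intro eq_vecI) auto
    moreover have "u \<noteq> 0\<^sub>v n"
    proof
      assume "u = 0\<^sub>v n"
      then have z: "\<And>j. j < n \<Longrightarrow> \<xi> (Suc j) = 0" using u(2) by simp
      then have "\<xi> 0 = 0" using \<xi>(2) by (simp add: sum.atMost_shift)
      with z have "\<xi> i = 0" if "i \<le> n" for i using that by (cases i) auto
      then show False using \<xi>(1) by blast
    qed
    ultimately show "det ?G = 0"
      using det_0_iff_vec_prod_zero[OF G] u(1) by blast
  qed
  then show ?thesis by (simp add: s_def)
qed

section \<open>Maximal generalised roundness\<close>

theorem theorem1p1:
  fixes X :: "'a set" and d :: "'a \<Rightarrow> 'a \<Rightarrow> real" and x :: "nat \<Rightarrow> 'a" and n :: nat
  assumes "Metric_space X d"
    and "X = x ` {0..n}" and "inj_on x {0..n}"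
    and "mgr X d < \<infinity>"
  shows "\<exists>m::real. mgr X d = ereal m \<and>
    is_minimum m {p. p > 0 \<and> det (cayley_menger_mat d x n p) = 0} \<and>
    is_minimum m {p. p > 0 \<and> det (gramian_mat d x n p) = 0}"
proof -
  interpret Metric_space X d by fact
  define s where "s = (\<lambda>p i j. d (x i) (x j) powr p)"
  define A where "A = {p. 0 \<le> p \<and> neg_type {..n} (s p)}"
  have X: "X = x ` {..n}" and inj: "inj_on x {..n}"
    using assms(2,3) by (simp_all add: atLeast0AtMost)
  have xX: "x i \<in> X" if "i \<le> n" for i using X that by auto
  have zero_iff: "d (x i) (x j) = 0 \<longleftrightarrow> i = j" if "i \<le> n" "j \<le> n" for i j
    using xX inj that by (auto simp: inj_on_eq_iff)
  have sym: "s p i j = s p j i" for p i j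
    by (simp add: s_def commute)
  have zero: "s p i i = 0" if "i \<le> n" for p i
    using zero_iff that by (simp add: s_def)
  have pos: "0 < s p i j" if "i \<le> n" "j \<le> n" "i \<noteq> j" for p i j
    using zero_iff that by (simp add: s_def)
  have lim: "((\<lambda>p. s p i j) \<longlongrightarrow> s q i j) (at q)" for q i j
    unfolding s_def by (rule tendsto_powr_exponent)
  have mgr: "mgr X d = Sup (ereal ` A)"
    using generalised_roundness_iff_neg_type[of X d] neg_type_image_iff[OF inj, folded X] X
    by (simp add: mgr_def A_def s_def commute)

  have strict0: "strict_neg_type {..n} (s 0)"
  proof -
    have "quadratic_form {..n} (s 0) \<xi> = quadratic_form {..n} (\<lambda>i j. if i = j then 0 else 1) \<xi>" for \<xi>
      by (intro quadratic_form_cong) (simp_all add: s_def zero_iff)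
    then show ?thesis
      using strict_neg_type_discrete[of "{..n}"] by (simp add: strict_neg_type_def)
  qed
  then have "0 \<in> A" by (simp add: A_def strict_neg_type_imp_neg_type)
  then have "0 \<le> mgr X d" unfolding mgr zero_ereal_def by (intro Sup_upper imageI)
  then obtain m where m: "mgr X d = ereal m" "0 \<le> m"
    using assms(4) by (cases "mgr X d") auto
  have upper: "p \<le> m" if "p \<in> A" for p
  proof -
    have "ereal p \<le> mgr X d" unfolding mgr using that by (intro Sup_upper imageI)
    then show ?thesis using m by simp
  qed
  have approx: "\<exists>p\<in>A. r < p" if "r < m" for r
  proof -
    have "ereal r < Sup (ereal ` A)" using that m mgr by simp
    then show ?thesis by (auto simp: less_Sup_iff)
  qed

  have neg_m: "neg_type {..n} (s m)" unfolding neg_type_def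
  proof (intro allI impI, rule ccontr)
    fix \<xi> :: "nat \<Rightarrow> real" assume sum0: "sum \<xi> {..n} = 0" and "\<not> quadratic_form {..n} (s m) \<xi> \<le> 0"
    then have gt: "0 < quadratic_form {..n} (s m) \<xi>" by simp
    have "((\<lambda>p. quadratic_form {..n} (s p) \<xi>) \<longlongrightarrow> quadratic_form {..n} (s m) \<xi>) (at m)"
      unfolding quadratic_form_def by (intro tendsto_intros lim)
    from order_tendstoD(1)[OF this gt] obtain \<delta> where \<delta>: "\<delta> > 0"
      "\<And>p. p \<noteq> m \<Longrightarrow> \<bar>p - m\<bar> < \<delta> \<Longrightarrow> 0 < quadratic_form {..n} (s p) \<xi>"
      unfolding eventually_at dist_real_def by blast
    obtain p where p: "p \<in> A" "m - \<delta> < p" using approx[of "m - \<delta>"] \<delta>(1) by auto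
    then have "0 < quadratic_form {..n} (s p) \<xi>"
      using upper[OF p(1)] \<delta>(2)[of p] gt by (cases "p = m") auto
    moreover have "quadratic_form {..n} (s p) \<xi> \<le> 0"
      using p(1) sum0 by (simp add: A_def neg_type_def)
    ultimately show False by simp
  qed
  have not_strict_m: "\<not> strict_neg_type {..n} (s m)"
  proof
    assume "strict_neg_type {..n} (s m)"
    then have "eventually (\<lambda>p. strict_neg_type {..n} (s p)) (at m)"
      by (rule strict_neg_type_eventually[OF finite_atMost _ lim])
    then obtain \<delta> where \<delta>: "\<delta> > 0" "\<And>p. p \<noteq> m \<Longrightarrow> \<bar>p - m\<bar> < \<delta> \<Longrightarrow> strict_neg_type {..n} (s p)"
      unfolding eventually_at dist_real_def by blast
    then have "m + \<delta> / 2 \<in> A"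
      using m(2) by (simp add: A_def strict_neg_type_imp_neg_type)
    then show False using upper \<delta>(1) by fastforce
  qed
  with strict0 m(2) have m_pos: "0 < m" by (cases "m = 0") auto
  have potential_m: "has_constant_potential {..n} (s m)"
    by (intro degenerate_neg_type_has_constant_potential neg_m not_strict_m sym) simp
  have no_potential: "\<not> has_constant_potential {..n} (s p)" if p: "0 < p" "p < m" for p
  proof -
    have "strict_neg_type {..n} (\<lambda>i j. s m i j powr (p / m))"
      by (rule neg_type_powr_imp_strict[OF _ sym _ _ neg_m]) (use p zero pos in auto)
    also have "(\<lambda>i j. s m i j powr (p / m)) = s p"
      using m_pos by (simp add: s_def powr_powr fun_eq_iff)
    finally show ?thesis by (rule strict_neg_type_no_constant_potential)
  qed
  have det: "det (cayley_menger_mat d x n p) = 0 \<longleftrightarrow> has_constant_potential {..n} (s p)"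
    "det (gramian_mat d x n p) = 0 \<longleftrightarrow> has_constant_potential {..n} (s p)" for p
    using det_cayley_menger_mat_eq_0_iff[of d x n p] det_gramian_mat_eq_0_iff[of n d x p] zero_iff
    by (simp_all add: s_def commute)
  have "is_minimum m {p. p > 0 \<and> has_constant_potential {..n} (s p)}"
    using m_pos potential_m no_potential by (force simp: is_minimum_def not_less[symmetric])
  then show ?thesis using m(1) by (simp add: det)
qed

end
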